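(* Let $G=GL_2(\mathbb{C})\times GL_2(\mathbb{C})\times GL_2(\mathbb{C})$ act on $V=\mathbb{C}^2\otimes\mathbb{C}^2\otimes\mathbb{C}^2$ in the standard way, and let $f_4$, $\pi_{12},\pi_{13},\pi_{23},\rho_3$ be the polynomial and the spaces of polynomials on $V$ defined in the context. There are exactly six nonzero $G$-orbits in $V$ (respectively, six $G$-orbits in $\mathbb{P}(V)$), and they are described as follows (as subsets of $V\setminus\{0\}$, respectively of $\mathbb{P}(V)$): (1) The open orbit is given by $f_4\ne 0$. It consists of rank two tensors, and it is represented by $e_1\otimes e_1\otimes e_1+e_2\otimes e_2\otimes e_2$. (2) The next orbit, which is open in the zero set of $f_4$, is given by $f_4=0$, $\rho_3\neq 0$. It consists of rank three tensors, and it is represented by $e_1\otimes e_1\otimes e_1+e_2\otimes e_1\otimes e_2+e_2\otimes e_2\otimes e_1$. (3) The next three orbits are given by $\pi_{12}=\pi_{13}=0,\ \pi_{23}\ne 0$, respectively $\pi_{12}=\pi_{23}=0,\ \pi_{13}\neq 0$, respectively $\pi_{13}=\pi_{23}=0,\ \pi_{12}\neq 0$. Each of these orbits consists of rank two tensors, and they are represented by $e_1\otimes e_1\otimes e_2+e_1\otimes e_2\otimes e_1$, respectively $e_1\otimes e_1\otimes e_2+e_2\otimes e_1\otimes e_1$, respectively $e_1\otimes e_2\otimes e_1+e_2\otimes e_1\otimes e_1$. (4) The orbit of decomposable (rank one) tensors is given by $\pi_{12}=\pi_{13}=\pi_{23}=0$, and it is represented by $e_1\otimes e_1\otimes e_1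$.
   Context: $e_1,e_2$ is the standard basis of $\mathbb{C}^2$ and $x_{ijk}$ ($i,j,k\in\{1,2\}$) are the coordinate functions on $V$ with respect to the basis $e_i\otimes e_j\otimes e_k$. The rank of a tensor $u\in V$ is the minimal number of decomposable tensors $v_1\otimes v_2\otimes v_3$ that add up to $u$. Define $d_{12}=x_{111}x_{221}-x_{121}x_{211}$, $\omega_{12}=x_{111}x_{222}+x_{112}x_{221}-x_{121}x_{212}-x_{122}x_{211}$, $\eta_{12}=x_{112}x_{222}-x_{122}x_{212}$; $d_{13}=x_{111}x_{212}-x_{112}x_{211}$, $\omega_{13}=x_{111}x_{222}+x_{121}x_{212}-x_{112}x_{221}-x_{122}x_{211}$, $\eta_{13}=x_{121}x_{222}-x_{122}x_{221}$; $d_{23}=x_{111}x_{122}-x_{112}x_{121}$, $\omega_{23}=x_{111}x_{222}+x_{122}x_{211}-x_{112}x_{221}-x_{121}x_{212}$, $\eta_{23}=x_{211}x_{222}-x_{212}x_{221}$. $\pi_{ij}$ is the ($G$-stable) span of $d_{ij},\omega_{ij},\eta_{ij}$. $\rho_3$ is the ($G$-stable) span of the eight polynomials $x_{ij1}\omega_{12}-2x_{ij2}d_{12}$ and $2x_{ij1}\eta_{12}-x_{ij2}\omega_{12}$ for $i,j\in\{1,2\}$; it is the $G$-representation generated by $f_3=x_{111}\omega_{12}-2x_{112}d_{12}$. Finally $f_4=\omega_{12}^2-4d_{12}\eta_{12}$. For a space $\pi$ of polynomials, "$\pi=0$" at a point means that all polynomials in $\pi$ vanish at that point, and "$\pi\ne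 0$" means that not all of them vanish there. *)

theory Defs
  imports "HOL-Analysis.Analysis" "HOL-Algebra.Group_Action" "HOL-Library.Function_Algebras"
begin

section \<open>The tensor space and the action of the group\<close>

text \<open>A tensor in \<open>\<complex>\<^sup>2 \<otimes> \<complex>\<^sup>2 \<otimes> \<complex>\<^sup>2\<close> is given by its coordinates with respect to the basis
  \<open>e\<^sub>i \<otimes> e\<^sub>j \<otimes> e\<^sub>k\<close>: the coordinate function \<open>x\<^sub>i\<^sub>j\<^sub>k\<close> is \<open>\<lambda>u. u $ (i, j, k)\<close>. The index type
  \<^typ>\<open>2\<close> has the two elements \<open>1\<close> and \<open>2\<close>. The complex vector space structure is given by
  the scalar multiplication \<open>(*s)\<close>, i.e. by the \<open>vec\<close> interpretation of the
  library.\<close>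

type_synonym V = "complex ^ (2 \<times> 2 \<times> 2)"

definition tensor :: "complex ^ 2 \<Rightarrow> complex ^ 2 \<Rightarrow> complex ^ 2 \<Rightarrow> V" where
  "tensor v1 v2 v3 = (\<chi> t. case t of (i, j, k) \<Rightarrow> v1 $ i * v2 $ j * v3 $ k)"

definition ee :: "2 \<Rightarrow> complex ^ 2" where
  "ee i = axis i 1"

definition decomposable :: "V \<Rightarrow> bool" where
  "decomposable u \<longleftrightarrow> (\<exists>v1 v2 v3. u = tensor v1 v2 v3)"

definition tensor_rank :: "V \<Rightarrow> nat" where
  "tensor_rank u = (LEAST r. \<exists>w. (\<forall>n<r. decomposable (w n)) \<and> u = (\<Sum>n<r. w n))"

definition GL2 :: "(complex ^ 2 ^ 2) monoid" where
  "GL2 = \<lparr>carrier = {A. invertible A}, mult = (**), one = mat 1\<rparr>"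

definition G :: "((complex ^ 2 ^ 2) \<times> (complex ^ 2 ^ 2) \<times> (complex ^ 2 ^ 2)) monoid" where
  "G = GL2 \<times>\<times> GL2 \<times>\<times> GL2"

definition act :: "(complex ^ 2 ^ 2) \<times> (complex ^ 2 ^ 2) \<times> (complex ^ 2 ^ 2) \<Rightarrow> V \<Rightarrow> V" where
  "act g u = (case g of (g1, g2, g3) \<Rightarrow>
     (\<chi> t. case t of (i, j, k) \<Rightarrow>
        \<Sum>a\<in>UNIV. \<Sum>b\<in>UNIV. \<Sum>c\<in>UNIV. g1 $ i $ a * g2 $ j $ b * g3 $ k $ c * u $ (a, b, c)))"

lemma act_tensor: "act (g1, g2, g3) (tensor v1 v2 v3) = tensor (g1 *v v1) (g2 *v v2) (g3 *v v3)"
  by (simp add: act_def tensor_def vec_eq_iff matrix_vector_mult_def sum_2 algebra_simps)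

lemma group_GL2: "group GL2"
proof (rule groupI)
  fix A assume "A \<in> carrier GL2"
  then obtain B where "A ** B = mat 1" "B ** A = mat 1"
    by (auto simp: GL2_def invertible_def)
  then show "\<exists>B\<in>carrier GL2. B \<otimes>\<^bsub>GL2\<^esub> A = \<one>\<^bsub>GL2\<^esub>"
    by (intro bexI[of _ B]) (auto simp: GL2_def invertible_def)
next
  have "invertible (mat 1 :: complex ^ 2 ^ 2)"
    unfolding invertible_def by (intro exI[of _ "mat 1"]) simp
  then show "\<one>\<^bsub>GL2\<^esub> \<in> carrier GL2"
    by (simp add: GL2_def)
qed (auto simp: GL2_def matrix_mul_assoc invertible_mult)

lemma act_mult: "act (g \<otimes>\<^bsub>G\<^esub> h) u = act g (act h u)"
  by (cases g; cases h)
    (simp add: act_def G_def GL2_def vec_eq_iff matrix_matrix_mult_def sum_2 algebra_simps)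

lemma act_one: "act \<one>\<^bsub>G\<^esub> u = u"
  by (simp add: act_def G_def GL2_def vec_eq_iff mat_def sum_2 forall_2)

lemma group_G: "group G"
  unfolding G_def by (intro DirProd_group group_GL2)

lemma group_action_act: "group_action G UNIV act"
proof -
  interpret group G by (rule group_G)
  have bij: "bij (act g)" if "g \<in> carrier G" for g
  proof (rule o_bij)
    show "act (inv\<^bsub>G\<^esub> g) \<circ> act g = id" "act g \<circ> act (inv\<^bsub>G\<^esub> g) = id"
      using that by (simp_all add: fun_eq_iff act_one flip: act_mult)
  qed
  then have "act \<in> hom G (BijGroup UNIV)"
    by (auto simp: hom_def BijGroup_def Bij_def compose_def act_mult fun_eq_iff)
  then show ?thesis
    by (simp add: group_action_def group_hom_def group_hom_axioms_def group_G group_BijGroup)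
qed

section \<open>Projective space\<close>

definition PV :: "V set set" where
  "PV = {L. vec.subspace L \<and> vec.dim L = 1}"

definition pact :: "(complex ^ 2 ^ 2) \<times> (complex ^ 2 ^ 2) \<times> (complex ^ 2 ^ 2) \<Rightarrow> V set \<Rightarrow> V set" where
  "pact g L = act g ` L"

section \<open>Polynomials and the Zariski topologies\<close>

text \<open>Since \<open>\<complex>\<close> is infinite, polynomials on \<^typ>\<open>V\<close> are identified with the functions they define.\<close>

inductive poly_fun :: "(V \<Rightarrow> complex) \<Rightarrow> bool" where
  poly_fun_const: "poly_fun (\<lambda>u. c)"
| poly_fun_coord: "poly_fun (\<lambda>u. u $ t)"
| poly_fun_add: "poly_fun p \<Longrightarrow> poly_fun q \<Longrightarrow> poly_fun (\<lambda>u. p u + q u)"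
| poly_fun_mult: "poly_fun p \<Longrightarrow> poly_fun q \<Longrightarrow> poly_fun (\<lambda>u. p u * q u)"

definition homogeneous :: "(V \<Rightarrow> complex) \<Rightarrow> bool" where
  "homogeneous p \<longleftrightarrow> (\<exists>d::nat. \<forall>c u. p (c *s u) = c ^ d * p u)"

definition zeros :: "(V \<Rightarrow> complex) set \<Rightarrow> V set" where
  "zeros \<pi> = {u. \<forall>p\<in>\<pi>. p u = 0}"

text \<open>The next definition is meant for sets of homogeneous polynomials (and their spans in a
  fixed degree), for which vanishing on a line is the same as vanishing at any of its nonzero
  vectors.\<close>

definition pzeros :: "(V \<Rightarrow> complex) set \<Rightarrow> V set set" where
  "pzeros \<pi> = {L \<in> PV. L \<subseteq> zeros \<pi>}"

definition zariski :: "V topology" where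
  "zariski = topology_generated_by {- zeros {p} | p. poly_fun p}"

definition pzariski :: "V set topology" where
  "pzariski = topology_generated_by {PV - pzeros {p} | p. poly_fun p \<and> homogeneous p}"

section \<open>The covariants\<close>

definition d12 :: "V \<Rightarrow> complex" where
  "d12 x = x$(1,1,1) * x$(2,2,1) - x$(1,2,1) * x$(2,1,1)"
definition omega12 :: "V \<Rightarrow> complex" where
  "omega12 x = x$(1,1,1) * x$(2,2,2) + x$(1,1,2) * x$(2,2,1)
             - x$(1,2,1) * x$(2,1,2) - x$(1,2,2) * x$(2,1,1)"
definition eta12 :: "V \<Rightarrow> complex" where
  "eta12 x = x$(1,1,2) * x$(2,2,2) - x$(1,2,2) * x$(2,1,2)"

definition d13 :: "V \<Rightarrow> complex" where
  "d13 x = x$(1,1,1) * x$(2,1,2) - x$(1,1,2) * x$(2,1,1)"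
definition omega13 :: "V \<Rightarrow> complex" where
  "omega13 x = x$(1,1,1) * x$(2,2,2) + x$(1,2,1) * x$(2,1,2)
             - x$(1,1,2) * x$(2,2,1) - x$(1,2,2) * x$(2,1,1)"
definition eta13 :: "V \<Rightarrow> complex" where
  "eta13 x = x$(1,2,1) * x$(2,2,2) - x$(1,2,2) * x$(2,2,1)"

definition d23 :: "V \<Rightarrow> complex" where
  "d23 x = x$(1,1,1) * x$(1,2,2) - x$(1,1,2) * x$(1,2,1)"
definition omega23 :: "V \<Rightarrow> complex" where
  "omega23 x = x$(1,1,1) * x$(2,2,2) + x$(1,2,2) * x$(2,1,1)
             - x$(1,1,2) * x$(2,2,1) - x$(1,2,1) * x$(2,1,2)"
definition eta23 :: "V \<Rightarrow> complex" where
  "eta23 x = x$(2,1,1) * x$(2,2,2) - x$(2,1,2) * x$(2,2,1)"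

definition f4 :: "V \<Rightarrow> complex" where
  "f4 x = (omega12 x)\<^sup>2 - 4 * d12 x * eta12 x"

global_interpretation fn: vector_space "\<lambda>(c::complex) (p::V \<Rightarrow> complex) u. c * p u"
  by unfold_locales (auto simp: fun_eq_iff algebra_simps)

definition pi12 :: "(V \<Rightarrow> complex) set" where
  "pi12 = fn.span {d12, omega12, eta12}"
definition pi13 :: "(V \<Rightarrow> complex) set" where
  "pi13 = fn.span {d13, omega13, eta13}"
definition pi23 :: "(V \<Rightarrow> complex) set" where
  "pi23 = fn.span {d23, omega23, eta23}"

definition rho3 :: "(V \<Rightarrow> complex) set" where
  "rho3 = fn.span
     ({\<lambda>x. x$(i,j,1) * omega12 x - 2 * x$(i,j,2) * d12 x | i j. True}
    \<union> {\<lambda>x. 2 * x$(i,j,1) * eta12 x - x$(i,j,2) * omega12 x | i j. True})"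

end

theory Submission
  imports Defs
begin

text \<open>A tensor is a pencil of 2 by 2 matrices (its slices along the third factor), and
  \<open>d12 s\<^sup>2 + omega12 s t + eta12 t\<^sup>2\<close> is the determinant of this pencil. Over \<open>\<complex>\<close> this form has a root,
  so after a change of basis in the third factor one slice is \<open>p \<otimes> q\<close>. Expanding the other slice in
  bases extending \<open>p\<close> and \<open>q\<close> and absorbing coefficients leaves six normal forms, so the orbits of
  the six representatives exhaust the nonzero tensors. Evaluating the covariants on the normal
  forms shows that each orbit satisfies the equations of its own stratum and of no other one; since
  the orbits are exhaustive, each stratum is then equal to its orbit. A sum of two decomposable
  tensors with \<open>f4 = 0\<close> satisfies \<open>rho3 = 0\<close>, which gives rank three in case (2). Along a line in the
  direction of the first representative \<open>f4\<close> is a monic quartic, so \<open>f4 \<noteq> 0\<close> is dense even for the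
  Euclidean topology and no other orbit is open. All strata are cones, which transfers everything
  to the projective space.\<close>

section \<open>Determinants of pairs of vectors, extensionality, linearity of the action\<close>

definition det2 :: "complex ^ 2 \<Rightarrow> complex ^ 2 \<Rightarrow> complex" where
  "det2 a b = a $ 1 * b $ 2 - a $ 2 * b $ 1"

lemma tensor_nth [simp]: "tensor a b c $ (i, j, k) = a $ i * b $ j * c $ k"
  by (simp add: tensor_def)

lemma V_eq_iff: "(u :: V) = v \<longleftrightarrow> (\<forall>i j k. u $ (i, j, k) = v $ (i, j, k))"
  by (auto simp: vec_eq_iff)

lemma vec2_eq_iff: "(a :: complex ^ 2) = b \<longleftrightarrow> a $ 1 = b $ 1 \<and> a $ 2 = b $ 2"
  by (simp add: vec_eq_iff forall_2)

lemma act_add: "act g (u + v) = act g u + act g v"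
  by (cases g) (simp add: act_def vec_eq_iff sum_2 algebra_simps)

lemma act_scale: "act g (c *s u) = c *s act g u"
  by (cases g) (simp add: act_def vec_eq_iff sum_2 algebra_simps)

section \<open>Parametrised orbits\<close>

text \<open>The two images are the columns of \<open>g\<close>, and a matrix is invertible iff its
  columns form a basis. With \<open>P\<close> abstract, the equivalence can be applied to one factor
  of the group at a time.\<close>

lemma ex_invertible_iff:
  "(\<exists>g. invertible g \<and> P (g *v ee 1) (g *v ee 2)) \<longleftrightarrow> (\<exists>a a'. det2 a a' \<noteq> 0 \<and> P a a')"
proof safe
  fix g :: "complex ^ 2 ^ 2"
  assume "invertible g" "P (g *v ee 1) (g *v ee 2)"
  moreover from this have "det2 (g *v ee 1) (g *v ee 2) \<noteq> 0"
    by (simp add: invertible_det_nz det_2 det2_def ee_def matrix_vector_mult_def axis_def sum_2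
        mult.commute)
  ultimately show "\<exists>a a'. det2 a a' \<noteq> 0 \<and> P a a'"
    by blast
next
  fix a a' :: "complex ^ 2"
  assume *: "det2 a a' \<noteq> 0" "P a a'"
  define g :: "complex ^ 2 ^ 2" where "g = (\<chi> i j. if j = 1 then a $ i else a' $ i)"
  have "g *v ee 1 = a" "g *v ee 2 = a'"
    by (simp_all add: g_def ee_def matrix_vector_mult_def axis_def sum_2 vec2_eq_iff)
  moreover have "invertible g"
    using * by (simp add: invertible_det_nz det_2 det2_def g_def mult.commute)
  ultimately show "\<exists>g. invertible g \<and> P (g *v ee 1) (g *v ee 2)"
    using * by auto
qed

lemma mem_orbit_iff:
  "u \<in> orbit G act r \<longleftrightarrow>
    (\<exists>g1. invertible g1 \<and> (\<exists>g2. invertible g2 \<and> (\<exists>g3. invertible g3 \<and> u = act (g1, g2, g3) r)))"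
  by (auto simp: orbit_def G_def GL2_def)

text \<open>In this and the next five sets the pairs \<open>a, a'\<close>, \<open>b, b'\<close>,
  \<open>c, c'\<close> are bases that replace \<open>ee 1, ee 2\<close> in the representative. The
  quantifiers are nested as three uses of \<open>ex_invertible_iff\<close> leave them, so that
  \<open>orbit_representatives\<close> ends by reflexivity.\<close>

definition orb1 :: "V set" where
  "orb1 = {u. \<exists>a a'. det2 a a' \<noteq> 0 \<and> (\<exists>b b'. det2 b b' \<noteq> 0 \<and> (\<exists>c c'. det2 c c' \<noteq> 0 \<and>
     u = tensor a b c + tensor a' b' c'))}"

definition orb2 :: "V set" where
  "orb2 = {u. \<exists>a a'. det2 a a' \<noteq> 0 \<and> (\<exists>b b'. det2 b b' \<noteq> 0 \<and> (\<exists>c c'. det2 c c' \<noteq> 0 \<and>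
     u = tensor a b c + tensor a' b c' + tensor a' b' c))}"

definition orb3a :: "V set" where
  "orb3a = {u. \<exists>a a'. det2 a a' \<noteq> 0 \<and> (\<exists>b b'. det2 b b' \<noteq> 0 \<and> (\<exists>c c'. det2 c c' \<noteq> 0 \<and>
     u = tensor a b c' + tensor a b' c))}"

definition orb3b :: "V set" where
  "orb3b = {u. \<exists>a a'. det2 a a' \<noteq> 0 \<and> (\<exists>b b'. det2 b b' \<noteq> 0 \<and> (\<exists>c c'. det2 c c' \<noteq> 0 \<and>
     u = tensor a b c' + tensor a' b c))}"

definition orb3c :: "V set" where
  "orb3c = {u. \<exists>a a'. det2 a a' \<noteq> 0 \<and> (\<exists>b b'. det2 b b' \<noteq> 0 \<and> (\<exists>c c'. det2 c c' \<noteq> 0 \<and>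
     u = tensor a b' c + tensor a' b c))}"

definition orb4 :: "V set" where
  "orb4 = {u. \<exists>a a'. det2 a a' \<noteq> 0 \<and> (\<exists>b b'. det2 b b' \<noteq> 0 \<and> (\<exists>c c'. det2 c c' \<noteq> 0 \<and>
     u = tensor a b c))}"

lemmas orb_defs = orb1_def orb2_def orb3a_def orb3b_def orb3c_def orb4_def

lemma orbit_representatives:
  "orbit G act (tensor (ee 1) (ee 1) (ee 1) + tensor (ee 2) (ee 2) (ee 2)) = orb1"
  "orbit G act (tensor (ee 1) (ee 1) (ee 1) + tensor (ee 2) (ee 1) (ee 2)
     + tensor (ee 2) (ee 2) (ee 1)) = orb2"
  "orbit G act (tensor (ee 1) (ee 1) (ee 2) + tensor (ee 1) (ee 2) (ee 1)) = orb3a"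
  "orbit G act (tensor (ee 1) (ee 1) (ee 2) + tensor (ee 2) (ee 1) (ee 1)) = orb3b"
  "orbit G act (tensor (ee 1) (ee 2) (ee 1) + tensor (ee 2) (ee 1) (ee 1)) = orb3c"
  "orbit G act (tensor (ee 1) (ee 1) (ee 1)) = orb4"
  unfolding set_eq_iff orb_defs mem_Collect_eq mem_orbit_iff act_add act_tensor
  by (subst ex_invertible_iff, subst ex_invertible_iff, subst ex_invertible_iff, rule allI,
      rule refl)+

section \<open>Normal forms\<close>

lemma nonzero_form_root:
  fixes d w e :: complex
  obtains s t where "s \<noteq> 0 \<or> t \<noteq> 0" "d * s\<^sup>2 + w * s * t + e * t\<^sup>2 = 0"
proof (cases "d = 0")
  case True
  show ?thesis by (rule that[of 1 0]) (use True in auto)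
next
  case False
  define r where "r = csqrt (w\<^sup>2 - 4 * d * e)"
  have r: "r\<^sup>2 = w\<^sup>2 - 4 * d * e" by (simp add: r_def)
  \<comment> \<open>This is the root (r - w) / (2 d) of the quadratic formula, written as a
    homogeneous pair with nonzero second entry.\<close>
  have "d * (r - w)\<^sup>2 + w * (r - w) * (2 * d) + e * (2 * d)\<^sup>2 = 0"
    using r by algebra
  then show ?thesis
    using False by (intro that[of "r - w" "2 * d"]) auto
qed

text \<open>If the first row is zero, the matrix is e_2 times the second row. Otherwise the second
  row is a multiple of the first, with factor read off in a column where the first row is nonzero.
  The zero matrix is allowed.\<close>

lemma rank_one_matrix:
  fixes m :: "2 \<Rightarrow> 2 \<Rightarrow> complex"
  assumes "m 1 1 * m 2 2 = m 1 2 * m 2 1"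
  obtains p q :: "complex ^ 2" where "\<And>i j. m i j = p $ i * q $ j"
proof -
  have "\<exists>p q :: complex ^ 2. \<forall>i j. m i j = p $ i * q $ j"
  proof (cases "m 1 1 = 0 \<and> m 1 2 = 0")
    case True
    then show ?thesis
      by (intro exI[of _ "vector [0, 1]"] exI[of _ "vector [m 2 1, m 2 2]"]) (simp add: forall_2)
  next
    case False
    then consider "m 1 1 \<noteq> 0" | "m 1 2 \<noteq> 0" by auto
    then show ?thesis
    proof cases
      case 1
      then show ?thesis using assms
        by (intro exI[of _ "vector [1, m 2 1 / m 1 1]"] exI[of _ "vector [m 1 1, m 1 2]"])
          (simp add: forall_2 field_simps)
    next
      case 2
      then show ?thesis using assms
        by (intro exI[of _ "vector [1, m 2 2 / m 1 2]"] exI[of _ "vector [m 1 1, m 1 2]"])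
          (simp add: forall_2 field_simps)
    qed
  qed
  then show ?thesis using that by blast
qed

lemma extend_to_basis:
  assumes "p \<noteq> 0"
  obtains p' where "det2 p p' \<noteq> 0"
proof (cases "p $ 1 = 0")
  case True
  then have "det2 p (vector [1, 0]) \<noteq> 0" using assms by (simp add: det2_def vec2_eq_iff)
  then show ?thesis by (rule that)
next
  case False
  then have "det2 p (vector [0, 1]) \<noteq> 0" by (simp add: det2_def)
  then show ?thesis by (rule that)
qed

lemma matrix_in_basis:
  fixes m :: "2 \<Rightarrow> 2 \<Rightarrow> complex"
  assumes "det2 p p' \<noteq> 0" "det2 q q' \<noteq> 0"
  obtains x y z w where
    "\<And>i j. m i j = x * (p $ i * q $ j) + y * (p $ i * q' $ j) + z * (p' $ i * q $ j)
       + w * (p' $ i * q' $ j)"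
proof -
  \<comment> \<open>Cramer's rule. It is applied first to the columns of \<open>m\<close>, with
    coefficients depending on \<open>j\<close>, and then to these coefficients as vectors in
    \<open>j\<close>.\<close>
  have e: "\<exists>x y. \<forall>i. v i = x * a $ i + y * b $ i" if "det2 a b \<noteq> 0" for a b and v :: "2 \<Rightarrow> complex"
    using that
    by (intro exI[of _ "(v 1 * b $ 2 - v 2 * b $ 1) / det2 a b"]
        exI[of _ "(a $ 1 * v 2 - a $ 2 * v 1) / det2 a b"])
      (simp add: forall_2 field_simps, simp add: det2_def algebra_simps)
  have "\<forall>j. \<exists>x y. \<forall>i. m i j = x * p $ i + y * p' $ i"
    by (intro allI e[OF assms(1)])
  then obtain f g where fg: "\<And>i j. m i j = f j * p $ i + g j * p' $ i" by metis
  obtain x y where f: "\<And>j. f j = x * q $ j + y * q' $ j" using e[OF assms(2)] by blast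
  obtain z w where g: "\<And>j. g j = z * q $ j + w * q' $ j" using e[OF assms(2)] by blast
  show ?thesis
    by (rule that[of x y z w]) (simp add: fg f g algebra_simps)
qed

text \<open>If \<open>B\<close> is zero, the rank of \<open>A\<close> separates \<open>orb4\<close>
  from \<open>orb3c\<close>. Otherwise the coefficients of \<open>A\<close> decide: \<open>w\<close>
  nonzero gives \<open>orb1\<close>; with \<open>w = 0\<close>, both \<open>y\<close> and
  \<open>z\<close> nonzero give \<open>orb2\<close>, only \<open>y\<close> gives
  \<open>orb3a\<close>, only \<open>z\<close> gives \<open>orb3b\<close>, and neither gives
  \<open>orb4\<close>.\<close>

lemma orb_cases:
  assumes "u \<noteq> 0"
  shows "u \<in> orb1 \<union> orb2 \<union> orb3a \<union> orb3b \<union> orb3c \<union> orb4"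
proof -
  obtain s t where st: "s \<noteq> 0 \<or> t \<noteq> 0"
    and root: "d12 u * s\<^sup>2 + omega12 u * s * t + eta12 u * t\<^sup>2 = 0"
    using nonzero_form_root by blast
  define B where "B i j = s * u $ (i, j, 1) + t * u $ (i, j, 2)" for i j
  have "B 1 1 * B 2 2 = B 1 2 * B 2 1"
    using root unfolding B_def d12_def omega12_def eta12_def by algebra
  then obtain p q where B: "\<And>i j. B i j = p $ i * q $ j"
    using rank_one_matrix[of B] by blast
  have "(vector [s, t] :: complex ^ 2) \<noteq> 0" using st by (auto simp: vec2_eq_iff)
  then obtain l where l: "det2 (vector [s, t]) l \<noteq> 0" by (rule extend_to_basis)
  \<comment> \<open>\<open>c, c'\<close> is the basis dual to \<open>l, (s, t)\<close>, so that the slices of \<open>u\<close> along it are \<open>A\<close> and \<open>B\<close>.\<close>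
  define D where "D = s * l $ 2 - t * l $ 1"
  have D: "D \<noteq> 0" using l by (simp add: D_def det2_def)
  define A where "A i j = l $ 1 * u $ (i, j, 1) + l $ 2 * u $ (i, j, 2)" for i j
  define c :: "complex ^ 2" where "c = vector [- t / D, s / D]"
  define c' :: "complex ^ 2" where "c' = vector [l $ 2 / D, - l $ 1 / D]"
  have "det2 c c' = - 1 / D"
    using D by (simp add: det2_def c_def c'_def field_simps) (simp add: D_def algebra_simps)
  then have cc': "det2 c c' \<noteq> 0" using D by simp
  have u: "u $ (i, j, k) = A i j * c $ k + p $ i * q $ j * c' $ k" for i j k
  proof -
    have "\<forall>k. D * u $ (i, j, k) = A i j * (D * c $ k) + B i j * (D * c' $ k)"
      using D by (simp add: forall_2 c_def c'_def, simp add: A_def B_def D_def algebra_simps)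
    then have "D * u $ (i, j, k) = D * (A i j * c $ k + B i j * c' $ k)"
      by (simp add: algebra_simps)
    then show ?thesis using D B by simp
  qed
  show ?thesis
  \<comment> \<open>This is the case \<open>B = 0\<close>, in which \<open>u\<close> is
    \<open>A\<close> tensored with \<open>c\<close>.\<close>
  proof (cases "p = 0 \<or> q = 0")
    case True
    then have u: "u $ (i, j, k) = A i j * c $ k" for i j k
      using u by auto
    have "A 1 1 \<noteq> 0 \<or> A 1 2 \<noteq> 0 \<or> A 2 1 \<noteq> 0 \<or> A 2 2 \<noteq> 0"
      using assms by (auto simp: V_eq_iff forall_2 u)
    show ?thesis
    proof (cases "A 1 1 * A 2 2 = A 1 2 * A 2 1")
      case True
      then obtain a b where A: "\<And>i j. A i j = a $ i * b $ j" using rank_one_matrix[of A] by blast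
      have "a \<noteq> 0" "b \<noteq> 0" using assms by (auto simp: V_eq_iff u A)
      then obtain a' b' where "det2 a a' \<noteq> 0" "det2 b b' \<noteq> 0" by (metis extend_to_basis)
      moreover have "u = tensor a b c" by (simp add: V_eq_iff u A)
      ultimately have "u \<in> orb4" using cc' unfolding orb4_def by blast
      then show ?thesis by blast
    next
      case False
      \<comment> \<open>\<open>A\<close> is e_1 times its first row plus e_2 times its second row,
        and the rows are independent because det \<open>A\<close> is nonzero.\<close>
      define a a' b b' :: "complex ^ 2" where "a = vector [0, 1]" and "a' = vector [1, 0]"
        and "b = vector [A 1 1, A 1 2]" and "b' = vector [A 2 1, A 2 2]"
      have "det2 a a' \<noteq> 0" "det2 b b' \<noteq> 0"
        using False by (auto simp: det2_def a_def a'_def b_def b'_def)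
      moreover have "u = tensor a b' c + tensor a' b c"
        by (simp add: V_eq_iff forall_2 u a_def a'_def b_def b'_def)
      ultimately have "u \<in> orb3c" using cc' unfolding orb3c_def by blast
      then show ?thesis by blast
    qed
  next
    case False
    then obtain p' q' where pq: "det2 p p' \<noteq> 0" "det2 q q' \<noteq> 0" by (metis extend_to_basis)
    then obtain x y z w where A: "\<And>i j. A i j = x * (p $ i * q $ j) + y * (p $ i * q' $ j)
        + z * (p' $ i * q $ j) + w * (p' $ i * q' $ j)"
      using matrix_in_basis by blast
    \<comment> \<open>Replacing \<open>c'\<close> by \<open>e\<close> removes the \<open>p \<otimes> q\<close> term from \<open>A\<close>.\<close>
    define e where "e = c' + x *s c"
    have ce: "det2 c e = det2 c c'" by (simp add: e_def det2_def algebra_simps)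
    have ec: "det2 e c = - det2 c c'" by (simp add: e_def det2_def algebra_simps)
    have qp: "det2 q' q = - det2 q q'" "det2 p' p = - det2 p p'" by (simp_all add: det2_def)
    have u: "u $ (i, j, k) = (y * (p $ i * q' $ j) + z * (p' $ i * q $ j)
      + w * (p' $ i * q' $ j)) * c $ k + p $ i * q $ j * e $ k" for i j k
      unfolding u A e_def by (simp add: algebra_simps)
    have scale [simp]: "det2 v (r *s v') = r * det2 v v'" "det2 (r *s v) v' = r * det2 v v'" for v r v'
      by (simp_all add: det2_def algebra_simps)
    consider "w \<noteq> 0" | "w = 0" "y \<noteq> 0" "z \<noteq> 0" | "w = 0" "y \<noteq> 0" "z = 0"
      | "w = 0" "y = 0" "z \<noteq> 0" | "w = 0" "y = 0" "z = 0" by blast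
    then show ?thesis
    proof cases
      case 1
      \<comment> \<open>Complete the product in \<open>w p' q' + y p q' + z p' q\<close>.\<close>
      define a' b' e' where "a' = w *s p' + y *s p" and "b' = q' + (z / w) *s q"
        and "e' = e - (y * z / w) *s c"
      have "det2 p a' \<noteq> 0" "det2 q b' \<noteq> 0" "det2 e' c \<noteq> 0"
      proof -
        have "det2 p a' = w * det2 p p'" "det2 q b' = det2 q q'" "det2 e' c = det2 e c"
          by (simp_all add: det2_def a'_def b'_def e'_def algebra_simps)
        then show "det2 p a' \<noteq> 0" "det2 q b' \<noteq> 0" "det2 e' c \<noteq> 0" using pq cc' ec 1 by auto
      qed
      \<comment> \<open>The product \<open>tensor a' b' c\<close> contains a surplus term y z / w
        times \<open>tensor p q c\<close>; the correction in \<open>e'\<close> cancels it.\<close>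
      moreover have "u = tensor p q e' + tensor a' b' c"
        using 1 by (simp add: V_eq_iff u a'_def b'_def e'_def field_simps)
      ultimately have "u \<in> orb1" unfolding orb1_def by blast
      then show ?thesis by blast
    next
      case 2
      have "det2 (z *s p') p \<noteq> 0" "det2 q (y *s q') \<noteq> 0" "det2 c e \<noteq> 0"
        using pq cc' ce qp 2 by simp_all
      moreover have "u = tensor (z *s p') q c + tensor p q e + tensor p (y *s q') c"
        using 2 by (simp add: V_eq_iff u algebra_simps)
      ultimately have "u \<in> orb2" unfolding orb2_def by blast
      then show ?thesis by blast
    next
      case 3
      have "det2 p p' \<noteq> 0" "det2 q (y *s q') \<noteq> 0" "det2 c e \<noteq> 0"
        using pq cc' ce 3 by simp_all
      moreover have "u = tensor p q e + tensor p (y *s q') c"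
        using 3 by (simp add: V_eq_iff u algebra_simps)
      ultimately have "u \<in> orb3a" unfolding orb3a_def by blast
      then show ?thesis by blast
    next
      case 4
      have "det2 p (z *s p') \<noteq> 0" "det2 q q' \<noteq> 0" "det2 c e \<noteq> 0"
        using pq cc' ce 4 by simp_all
      moreover have "u = tensor p q e + tensor (z *s p') q c"
        using 4 by (simp add: V_eq_iff u algebra_simps)
      ultimately have "u \<in> orb3b" unfolding orb3b_def by blast
      then show ?thesis by blast
    next
      case 5
      have "det2 p p' \<noteq> 0" "det2 q q' \<noteq> 0" "det2 e c \<noteq> 0"
        using pq cc' ec 5 by simp_all
      moreover have "u = tensor p q e"
        using 5 by (simp add: V_eq_iff u algebra_simps)
      ultimately have "u \<in> orb4" unfolding orb4_def by blast
      then show ?thesis by blast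
    qed
  qed
qed

lemmas covariant_defs = d12_def omega12_def eta12_def d13_def omega13_def eta13_def
  d23_def omega23_def eta23_def

section \<open>Covariants on the normal forms\<close>

lemma zeros_span: "zeros (fn.span S) = zeros S"
proof
  show "zeros (fn.span S) \<subseteq> zeros S" by (auto simp: zeros_def fn.span_base)
  show "zeros S \<subseteq> zeros (fn.span S)"
  proof
    fix u assume "u \<in> zeros S"
    then have "S \<subseteq> {p. p u = 0}" by (auto simp: zeros_def)
    then have "fn.span S \<subseteq> {p. p u = 0}"
      by (rule fn.span_minimal) (auto simp: fn.subspace_def)
    then show "u \<in> zeros (fn.span S)" by (auto simp: zeros_def)
  qed
qed

text \<open>The openness arguments need polynomiality and homogeneity of single polynomials; by
  \<open>zeros_rho3\<close> it suffices to check them on these generators.\<close>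

definition rho3_gens :: "(V \<Rightarrow> complex) set" where
  "rho3_gens = {\<lambda>x. x $ (i, j, 1) * omega12 x - 2 * x $ (i, j, 2) * d12 x | i j. True}
    \<union> {\<lambda>x. 2 * x $ (i, j, 1) * eta12 x - x $ (i, j, 2) * omega12 x | i j. True}"

lemma zeros_rho3: "zeros rho3 = zeros rho3_gens"
  unfolding rho3_def rho3_gens_def by (rule zeros_span)

lemma mem_zeros_iff:
  "u \<in> zeros {f4} \<longleftrightarrow> f4 u = 0"
  "u \<in> zeros pi12 \<longleftrightarrow> d12 u = 0 \<and> omega12 u = 0 \<and> eta12 u = 0"
  "u \<in> zeros pi13 \<longleftrightarrow> d13 u = 0 \<and> omega13 u = 0 \<and> eta13 u = 0"
  "u \<in> zeros pi23 \<longleftrightarrow> d23 u = 0 \<and> omega23 u = 0 \<and> eta23 u = 0"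
  "u \<in> zeros rho3 \<longleftrightarrow> (\<forall>i j. u $ (i, j, 1) * omega12 u - 2 * u $ (i, j, 2) * d12 u = 0
     \<and> 2 * u $ (i, j, 1) * eta12 u - u $ (i, j, 2) * omega12 u = 0)"
proof -
  have all_range: "(\<forall>p\<in>{F i j | i j. True}. p u = 0) \<longleftrightarrow> (\<forall>i j. F i j u = 0)"
    for F :: "2 \<Rightarrow> 2 \<Rightarrow> V \<Rightarrow> complex" by blast
  show "u \<in> zeros rho3 \<longleftrightarrow> (\<forall>i j. u $ (i, j, 1) * omega12 u - 2 * u $ (i, j, 2) * d12 u = 0
     \<and> 2 * u $ (i, j, 1) * eta12 u - u $ (i, j, 2) * omega12 u = 0)"
    unfolding zeros_rho3 unfolding rho3_gens_def zeros_def mem_Collect_eq ball_Un all_range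
    by (simp only: all_conj_distrib)
qed (simp_all add: pi12_def pi13_def pi23_def zeros_span, simp_all add: zeros_def)

text \<open>\<open>f4\<close> is the discriminant of the determinant of the pencil of slices. It is
  Cayley's hyperdeterminant, which is the same for slices along any of the three factors.\<close>

lemma f4_eq:
  "f4 u = (omega13 u)\<^sup>2 - 4 * d13 u * eta13 u"
  "f4 u = (omega23 u)\<^sup>2 - 4 * d23 u * eta23 u"
  unfolding f4_def covariant_defs by algebra+

text \<open>In the bases \<open>a, a'\<close> and \<open>b, b'\<close> the slices along the third
  factor are diagonal with entries from \<open>c\<close> and \<open>c'\<close>. The determinant of
  the pencil is thus a product of two linear forms with coefficient vectors \<open>c\<close> and
  \<open>c'\<close>, times two base change determinants. The other six values follow by permuting
  the factors.\<close>

lemma covariants_rank_two: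
  fixes a b c a' b' c' :: "complex ^ 2"
  defines "u \<equiv> tensor a b c + tensor a' b' c'"
  shows "d12 u = c $ 1 * c' $ 1 * (det2 a a' * det2 b b')"
    and "omega12 u = (c $ 1 * c' $ 2 + c $ 2 * c' $ 1) * (det2 a a' * det2 b b')"
    and "eta12 u = c $ 2 * c' $ 2 * (det2 a a' * det2 b b')"
    and "d13 u = b $ 1 * b' $ 1 * (det2 a a' * det2 c c')"
    and "omega13 u = (b $ 1 * b' $ 2 + b $ 2 * b' $ 1) * (det2 a a' * det2 c c')"
    and "eta13 u = b $ 2 * b' $ 2 * (det2 a a' * det2 c c')"
    and "d23 u = a $ 1 * a' $ 1 * (det2 b b' * det2 c c')"
    and "omega23 u = (a $ 1 * a' $ 2 + a $ 2 * a' $ 1) * (det2 b b' * det2 c c')"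
    and "eta23 u = a $ 2 * a' $ 2 * (det2 b b' * det2 c c')"
  by (simp_all add: u_def covariant_defs det2_def algebra_simps)

text \<open>Here the slices along the third factor are triangular with both diagonal entries from
  \<open>c\<close>, so the determinant of the pencil is the square of the linear form
  \<open>c\<close>, up to the base change factor. Along the second factor the same holds with
  \<open>b\<close>.\<close>

lemma covariants_three_terms:
  fixes a b c a' b' c' :: "complex ^ 2"
  defines "u \<equiv> tensor a b c + tensor a' b c' + tensor a' b' c"
  shows "d12 u = (c $ 1)\<^sup>2 * (det2 a a' * det2 b b')"
    and "omega12 u = 2 * c $ 1 * c $ 2 * (det2 a a' * det2 b b')"
    and "eta12 u = (c $ 2)\<^sup>2 * (det2 a a' * det2 b b')"
    and "d13 u = (b $ 1)\<^sup>2 * (det2 a a' * det2 c c')"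
    and "eta13 u = (b $ 2)\<^sup>2 * (det2 a a' * det2 c c')"
  by (simp_all add: u_def covariant_defs det2_def algebra_simps power2_eq_square)

lemma det2_nonzero: "det2 a b \<noteq> 0 \<Longrightarrow> a $ 1 = 0 \<Longrightarrow> a $ 2 \<noteq> 0"
  by (auto simp: det2_def)

lemma det2_self [simp]: "det2 a a = 0"
  by (simp add: det2_def)

lemma det2_swap: "det2 a b = 0 \<longleftrightarrow> det2 b a = 0"
  by (auto simp: det2_def algebra_simps)

text \<open>The discriminant of a product of two linear forms is the square of the determinant of
  their coefficients.\<close>

lemma f4_rank_two: "f4 (tensor a b c + tensor a' b' c') = (det2 a a' * det2 b b' * det2 c c')\<^sup>2"
  by (simp only: f4_def covariants_rank_two) (simp only: det2_def[of c c'], algebra)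

lemma orb1_not_f4: "u \<in> orb1 \<Longrightarrow> u \<notin> zeros {f4}"
  by (auto simp: orb1_def mem_zeros_iff f4_rank_two)

text \<open>Nonvanishing of \<open>rho3\<close> forces nonvanishing of \<open>pi12\<close> and so
  excludes the strata of \<open>orb3a\<close>, \<open>orb3b\<close> and \<open>orb4\<close>;
  nonvanishing of \<open>pi13\<close> excludes that of \<open>orb3c\<close>.\<close>

lemma orb2_covariants:
  assumes "u \<in> orb2"
  shows "u \<in> zeros {f4}" "u \<notin> zeros rho3" "u \<notin> zeros pi13"
proof -
  obtain a a' b b' c c' where nz: "det2 a a' \<noteq> 0" "det2 b b' \<noteq> 0" "det2 c c' \<noteq> 0"
    and u: "u = tensor a b c + tensor a' b c' + tensor a' b' c"
    using assms unfolding orb2_def by blast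
  \<comment> \<open>The order \<open>a b c a' c' b'\<close> is that of first occurrence in the sum
    of tensors, so each variable is instantiated by its namesake.\<close>
  note val = covariants_three_terms[of a b c a' c' b', folded u]
  show "u \<in> zeros {f4}" unfolding mem_zeros_iff f4_def val by algebra
  show "u \<notin> zeros pi13" using nz det2_nonzero[of b b'] by (auto simp: mem_zeros_iff val)
  show "u \<notin> zeros rho3"
  proof
    assume *: "u \<in> zeros rho3"
    let ?D = "det2 a a' * det2 b b'"
    have u1: "u $ (i, j, k) = (a $ i * b $ j + a' $ i * b' $ j) * c $ k + a' $ i * b $ j * c' $ k"
      for i j k by (simp add: u algebra_simps)
    \<comment> \<open>In the generator of \<open>rho3\<close> the part of \<open>u\<close> along
      \<open>c\<close> cancels and the part along \<open>c'\<close> leaves this product, up to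
      sign.\<close>
    have "2 * c $ 1 * ?D * det2 c c' * (a' $ i * b $ j) = 0" for i j
    proof -
      have "u $ (i, j, 1) * omega12 u - 2 * u $ (i, j, 2) * d12 u = 0"
        using * by (auto simp: mem_zeros_iff)
      then show ?thesis unfolding val u1 det2_def[of c c'] by algebra
    qed
    moreover have "2 * c $ 2 * ?D * det2 c c' * (a' $ i * b $ j) = 0" for i j
    proof -
      have "2 * u $ (i, j, 1) * eta12 u - u $ (i, j, 2) * omega12 u = 0"
        using * by (auto simp: mem_zeros_iff)
      then show ?thesis unfolding val u1 det2_def[of c c'] by algebra
    qed
    ultimately have "a' $ i * b $ j = 0" for i j
      using nz det2_nonzero[of c c'] by (cases "c $ 1 = 0") auto
    moreover have "det2 a' a \<noteq> 0" using nz det2_swap by blast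
    ultimately show False using nz det2_nonzero[of a' a] det2_nonzero[of b b'] by (metis mult_eq_0_iff)
  qed
qed

text \<open>A vector shared by both summands makes one \<open>det2\<close> in
  \<open>covariants_rank_two\<close> zero, which kills two of the three spaces. The third takes the
  values of a square of a nonzero linear form, times a nonzero factor.\<close>

lemma orb3_covariants:
  shows "u \<in> orb3a \<Longrightarrow> u \<in> zeros pi12 \<and> u \<in> zeros pi13 \<and> u \<notin> zeros pi23"
    and "u \<in> orb3b \<Longrightarrow> u \<in> zeros pi12 \<and> u \<in> zeros pi23 \<and> u \<notin> zeros pi13"
    and "u \<in> orb3c \<Longrightarrow> u \<in> zeros pi13 \<and> u \<in> zeros pi23 \<and> u \<notin> zeros pi12"
  by (auto simp: orb_defs mem_zeros_iff covariants_rank_two det2_swap dest: det2_nonzero)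

lemma zeros_pi_subset:
  "zeros pi12 \<subseteq> zeros {f4}" "zeros pi13 \<subseteq> zeros {f4}" "zeros pi23 \<subseteq> zeros {f4}"
  "zeros pi12 \<subseteq> zeros rho3"
proof -
  show "zeros pi12 \<subseteq> zeros {f4}" by (auto simp: mem_zeros_iff f4_def)
  show "zeros pi13 \<subseteq> zeros {f4}" by (auto simp: mem_zeros_iff f4_eq(1))
  show "zeros pi23 \<subseteq> zeros {f4}" by (auto simp: mem_zeros_iff f4_eq(2))
  show "zeros pi12 \<subseteq> zeros rho3" by (auto simp: mem_zeros_iff)
qed

text \<open>Among the orbits with \<open>f4 = 0\<close> other than \<open>orb2\<close>, this is the
  one where \<open>pi12\<close> does not vanish, so the inclusion of \<open>zeros pi12\<close> in
  \<open>zeros rho3\<close> does not cover it.\<close>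

lemma orb3c_in_rho3: "u \<in> orb3c \<Longrightarrow> u \<in> zeros rho3"
  by (auto simp: orb3c_def mem_zeros_iff covariants_rank_two algebra_simps)

lemma decomposable_in_zeros:
  assumes "decomposable u"
  shows "u \<in> zeros pi12" "u \<in> zeros pi13" "u \<in> zeros pi23"
  using assms by (auto simp: decomposable_def mem_zeros_iff covariant_defs algebra_simps)

text \<open>The generators of \<open>rho3\<close> take as values the coordinates of
  \<open>tensor a b c - tensor a' b' c'\<close>, times a factor whose square is
  \<open>f4\<close>.\<close>

lemma rank_two_in_rho3:
  assumes "f4 (tensor a b c + tensor a' b' c') = 0" (is "f4 ?u = 0")
  shows "?u \<in> zeros rho3"
proof -
  have z: "det2 a a' * det2 b b' * det2 c c' = 0" using assms by (simp add: f4_rank_two)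
  have "?u $ (i, j, 1) * omega12 ?u - 2 * ?u $ (i, j, 2) * d12 ?u
     = (det2 a a' * det2 b b' * det2 c c') * (a $ i * b $ j * c $ 1 - a' $ i * b' $ j * c' $ 1)"
    "2 * ?u $ (i, j, 1) * eta12 ?u - ?u $ (i, j, 2) * omega12 ?u
     = (det2 a a' * det2 b b' * det2 c c') * (a $ i * b $ j * c $ 2 - a' $ i * b' $ j * c' $ 2)" for i j
    unfolding covariants_rank_two det2_def[of c c'] vector_add_component tensor_nth by algebra+
  then show ?thesis using z by (simp add: mem_zeros_iff)
qed

lemma zero_mem_zeros:
  "0 \<in> zeros {f4}" "0 \<in> zeros rho3" "0 \<in> zeros pi12" "0 \<in> zeros pi13" "0 \<in> zeros pi23"
  by (simp_all add: mem_zeros_iff f4_def covariant_defs)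

lemma decomposable_zero: "decomposable 0"
  unfolding decomposable_def by (intro exI[of _ 0]) (simp add: V_eq_iff)

lemma orb4_decomposable:
  assumes "u \<in> orb4"
  shows "decomposable u" "u \<noteq> 0"
proof -
  obtain a a' b b' c c' where nz: "det2 a a' \<noteq> 0" "det2 b b' \<noteq> 0" "det2 c c' \<noteq> 0"
    and u: "u = tensor a b c"
    using assms unfolding orb4_def by blast
  show "decomposable u" using u by (auto simp: decomposable_def)
  obtain i j k where "a $ i \<noteq> 0" "b $ j \<noteq> 0" "c $ k \<noteq> 0"
    using nz det2_nonzero by metis
  then have "u $ (i, j, k) \<noteq> 0" using u by simp
  then show "u \<noteq> 0" by auto
qed

section \<open>The strata are the orbits\<close>

lemma strata:
  "UNIV - {0} - zeros {f4} = orb1"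
  "(UNIV - {0}) \<inter> zeros {f4} - zeros rho3 = orb2"
  "(UNIV - {0}) \<inter> zeros pi12 \<inter> zeros pi13 - zeros pi23 = orb3a"
  "(UNIV - {0}) \<inter> zeros pi12 \<inter> zeros pi23 - zeros pi13 = orb3b"
  "(UNIV - {0}) \<inter> zeros pi13 \<inter> zeros pi23 - zeros pi12 = orb3c"
  "(UNIV - {0}) \<inter> zeros pi12 \<inter> zeros pi13 \<inter> zeros pi23 = orb4"
proof -
  have 4: "u \<noteq> 0 \<and> u \<in> zeros pi12 \<and> u \<in> zeros pi13 \<and> u \<in> zeros pi23" if "u \<in> orb4" for u
    using orb4_decomposable[OF that] decomposable_in_zeros[of u] by blast
  have nz: "u \<noteq> 0" if "u \<in> orb1 \<or> u \<in> orb2 \<or> u \<in> orb3a \<or> u \<in> orb3b \<or> u \<in> orb3c" for u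
    using that orb1_not_f4 orb2_covariants orb3_covariants zero_mem_zeros by blast
  have cases: "u \<in> orb1 \<or> u \<in> orb2 \<or> u \<in> orb3a \<or> u \<in> orb3b \<or> u \<in> orb3c \<or> u \<in> orb4"
    if "u \<noteq> 0" for u
    using orb_cases[OF that] by blast
  note facts = 4 nz cases orb1_not_f4 orb2_covariants orb3_covariants orb3c_in_rho3 zeros_pi_subset[THEN subsetD]
  have mem: "u \<in> UNIV - {0} - zeros {f4} \<longleftrightarrow> u \<in> orb1"
    "u \<in> (UNIV - {0}) \<inter> zeros {f4} - zeros rho3 \<longleftrightarrow> u \<in> orb2"
    "u \<in> (UNIV - {0}) \<inter> zeros pi12 \<inter> zeros pi13 - zeros pi23 \<longleftrightarrow> u \<in> orb3a"
    "u \<in> (UNIV - {0}) \<inter> zeros pi12 \<inter> zeros pi23 - zeros pi13 \<longleftrightarrow> u \<in> orb3b"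
    "u \<in> (UNIV - {0}) \<inter> zeros pi13 \<inter> zeros pi23 - zeros pi12 \<longleftrightarrow> u \<in> orb3c"
    "u \<in> (UNIV - {0}) \<inter> zeros pi12 \<inter> zeros pi13 \<inter> zeros pi23 \<longleftrightarrow> u \<in> orb4" for u
    \<comment> \<open>For fixed \<open>u\<close> only propositional reasoning is left:
      \<open>u\<close> lies in some orbit, and each orbit fixes enough memberships to rule out all
      strata but its own.\<close>
    unfolding Diff_iff Int_iff singleton_iff using UNIV_I[of u] facts[of u] by argo+
  show "UNIV - {0} - zeros {f4} = orb1"
    "(UNIV - {0}) \<inter> zeros {f4} - zeros rho3 = orb2"
    "(UNIV - {0}) \<inter> zeros pi12 \<inter> zeros pi13 - zeros pi23 = orb3a"
    "(UNIV - {0}) \<inter> zeros pi12 \<inter> zeros pi23 - zeros pi13 = orb3b"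
    "(UNIV - {0}) \<inter> zeros pi13 \<inter> zeros pi23 - zeros pi12 = orb3c"
    "(UNIV - {0}) \<inter> zeros pi12 \<inter> zeros pi13 \<inter> zeros pi23 = orb4"
    using mem by (simp_all only: set_eq_iff simp_thms)
qed

section \<open>Counting the orbits\<close>

lemma orb_nonempty: "orb1 \<noteq> {}" "orb2 \<noteq> {}" "orb3a \<noteq> {}" "orb3b \<noteq> {}" "orb3c \<noteq> {}" "orb4 \<noteq> {}"
proof -
  have "orbit G act r \<noteq> {}" for r
    using group_action.orbit_refl[OF group_action_act, of r] by auto
  then show "orb1 \<noteq> {}" "orb2 \<noteq> {}" "orb3a \<noteq> {}" "orb3b \<noteq> {}" "orb3c \<noteq> {}" "orb4 \<noteq> {}"
    unfolding orbit_representatives[symmetric] by simp_all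
qed

lemma orbit_eq:
  assumes "x \<in> orbit G act r"
  shows "orbit G act x = orbit G act r"
  using assms group_action.orbit_sym[OF group_action_act] group_action.orbit_trans[OF group_action_act]
  by blast

lemma orbits_act: "orbits G (UNIV - {0}) act = {orb1, orb2, orb3a, orb3b, orb3c, orb4}"
proof -
  have eq: "orbit G act x = X" if "x \<in> X" "X \<in> {orb1, orb2, orb3a, orb3b, orb3c, orb4}" for x X
  proof -
    have "\<exists>r. X = orbit G act r" using that(2) orbit_representatives by (elim insertE) blast+
    then show ?thesis using orbit_eq that(1) by blast
  qed
  have union: "UNIV - {0} = orb1 \<union> orb2 \<union> orb3a \<union> orb3b \<union> orb3c \<union> orb4"
  proof
    show "UNIV - {0} \<subseteq> orb1 \<union> orb2 \<union> orb3a \<union> orb3b \<union> orb3c \<union> orb4" using orb_cases by blast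
    show "orb1 \<union> orb2 \<union> orb3a \<union> orb3b \<union> orb3c \<union> orb4 \<subseteq> UNIV - {0}"
      unfolding strata[symmetric] by blast
  qed
  have "orbits G (UNIV - {0}) act = (\<Union>X \<in> {orb1, orb2, orb3a, orb3b, orb3c, orb4}. orbit G act ` X)"
    unfolding orbits_def union by blast
  also have "\<dots> = (\<Union>X \<in> {orb1, orb2, orb3a, orb3b, orb3c, orb4}. {X})"
  proof (rule SUP_cong[OF refl])
    fix X assume X: "X \<in> {orb1, orb2, orb3a, orb3b, orb3c, orb4}"
    then have "X \<noteq> {}" using orb_nonempty by blast
    then show "orbit G act ` X = {X}" using eq[OF _ X] by auto
  qed
  finally show ?thesis by (simp only: UN_singleton)
qed

lemma orb_disjoint:
  "orb1 \<inter> orb2 = {}" "orb1 \<inter> orb3a = {}" "orb1 \<inter> orb3b = {}" "orb1 \<inter> orb3c = {}" "orb1 \<inter> orb4 = {}"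
  "orb2 \<inter> orb3a = {}" "orb2 \<inter> orb3b = {}" "orb2 \<inter> orb3c = {}" "orb2 \<inter> orb4 = {}"
  "orb3a \<inter> orb3b = {}" "orb3a \<inter> orb3c = {}" "orb3a \<inter> orb4 = {}"
  "orb3b \<inter> orb3c = {}" "orb3b \<inter> orb4 = {}" "orb3c \<inter> orb4 = {}"
  using zeros_pi_subset orb3c_in_rho3 unfolding strata[symmetric] by blast+

lemma orb_distinct: "distinct [orb1, orb2, orb3a, orb3b, orb3c, orb4]"
proof -
  have "X \<noteq> {} \<Longrightarrow> X \<noteq> Y" if "X \<inter> Y = {}" for X Y :: "V set" using that by blast
  note ne = orb_disjoint[THEN this]
  show ?thesis by (simp add: ne orb_nonempty)
qed

lemma card_orbits_act: "card (orbits G (UNIV - {0}) act) = 6"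
  using distinct_card[OF orb_distinct] by (simp add: orbits_act)

section \<open>Tensor rank\<close>

lemma tensor_rank_eqI:
  assumes "\<And>n. n < r \<Longrightarrow> decomposable (w n)" "u = (\<Sum>n<r. w n)"
    and "\<And>s w. s < r \<Longrightarrow> (\<forall>n<s. decomposable (w n)) \<Longrightarrow> u \<noteq> (\<Sum>n<s. w n)"
  shows "tensor_rank u = r"
  unfolding tensor_rank_def
proof (rule Least_equality)
  show "\<exists>w. (\<forall>n<r. decomposable (w n)) \<and> u = (\<Sum>n<r. w n)" using assms by blast
  show "r \<le> s" if "\<exists>w. (\<forall>n<s. decomposable (w n)) \<and> u = (\<Sum>n<s. w n)" for s
    using that assms(3)[of s] by (cases "s < r") auto
qed

lemma tensor_rank_1: "decomposable u \<Longrightarrow> u \<noteq> 0 \<Longrightarrow> tensor_rank u = 1"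
  by (rule tensor_rank_eqI[of _ "\<lambda>_. u"]) auto

text \<open>The empty sum is the zero tensor, which is decomposable, so one hypothesis excludes both
  lengths 0 and 1.\<close>

lemma tensor_rank_2:
  assumes "decomposable x" "decomposable y" "u = x + y" "\<not> decomposable u"
  shows "tensor_rank u = 2"
proof (rule tensor_rank_eqI[of _ "\<lambda>n. if n = 0 then x else y"])
  fix s and w :: "nat \<Rightarrow> V"
  assume "s < 2" and w: "\<forall>n<s. decomposable (w n)"
  then consider "s = 0" | "s = 1" by linarith
  then show "u \<noteq> (\<Sum>n<s. w n)"
    using w assms(4) decomposable_zero by cases auto
qed (use assms in \<open>auto simp: numeral_2_eq_2\<close>)

text \<open>Shorter sums are padded with zero tensors, so only sums of exactly two terms have to be
  excluded.\<close>

lemma tensor_rank_3: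
  assumes "decomposable x" "decomposable y" "decomposable z" "u = x + y + z"
    and "\<And>x y. decomposable x \<Longrightarrow> decomposable y \<Longrightarrow> u \<noteq> x + y"
  shows "tensor_rank u = 3"
proof (rule tensor_rank_eqI[of _ "\<lambda>n. if n = 0 then x else if n = 1 then y else z"])
  fix s and w :: "nat \<Rightarrow> V"
  assume "s < 3" and w: "\<forall>n<s. decomposable (w n)"
  then consider "s = 0" | "s = 1" | "s = 2" by linarith
  then show "u \<noteq> (\<Sum>n<s. w n)"
  proof cases
    case 1
    then show ?thesis using assms(5)[OF decomposable_zero decomposable_zero] by simp
  next
    case 2
    then show ?thesis using assms(5)[of "w 0" 0] w decomposable_zero by simp
  next
    case 3
    then show ?thesis using assms(5)[of "w 0" "w 1"] w by (simp add: numeral_2_eq_2)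
  qed
qed (use assms in \<open>auto simp: numeral_3_eq_3\<close>)

lemma orb_tensor_rank:
  "\<forall>u\<in>orb1. tensor_rank u = 2" "\<forall>u\<in>orb2. tensor_rank u = 3"
  "\<forall>u\<in>orb3a. tensor_rank u = 2" "\<forall>u\<in>orb3b. tensor_rank u = 2"
  "\<forall>u\<in>orb3c. tensor_rank u = 2" "\<forall>u\<in>orb4. tensor_rank u = 1"
proof -
  have dec [intro]: "decomposable (tensor a b c)" for a b c by (auto simp: decomposable_def)
  show "\<forall>u\<in>orb1. tensor_rank u = 2"
  proof
    fix u assume u: "u \<in> orb1"
    have "\<not> decomposable u" using orb1_not_f4[OF u] decomposable_in_zeros zeros_pi_subset by blast
    moreover obtain a b c a' b' c' where "u = tensor a b c + tensor a' b' c'"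
      using u unfolding orb1_def by blast
    ultimately show "tensor_rank u = 2" using tensor_rank_2 dec by blast
  qed
  show "\<forall>u\<in>orb2. tensor_rank u = 3"
  proof
    fix u assume u: "u \<in> orb2"
    obtain a b c a' b' c' where "u = tensor a b c + tensor a' b c' + tensor a' b' c"
      using u unfolding orb2_def by blast
    moreover have "u \<noteq> x + y" if "decomposable x" "decomposable y" for x y
      using that orb2_covariants[OF u] rank_two_in_rho3 unfolding decomposable_def mem_zeros_iff(1) by metis
    ultimately show "tensor_rank u = 3" using tensor_rank_3 dec by blast
  qed
  show "\<forall>u\<in>orb3a. tensor_rank u = 2"
  proof
    fix u assume u: "u \<in> orb3a"
    have "\<not> decomposable u" using orb3_covariants u decomposable_in_zeros by blast
    moreover obtain a b c b' c' where "u = tensor a b c' + tensor a b' c"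
      using u unfolding orb3a_def by blast
    ultimately show "tensor_rank u = 2" using tensor_rank_2 dec by blast
  qed
  show "\<forall>u\<in>orb3b. tensor_rank u = 2"
  proof
    fix u assume u: "u \<in> orb3b"
    have "\<not> decomposable u" using orb3_covariants u decomposable_in_zeros by blast
    moreover obtain a b c a' c' where "u = tensor a b c' + tensor a' b c"
      using u unfolding orb3b_def by blast
    ultimately show "tensor_rank u = 2" using tensor_rank_2 dec by blast
  qed
  show "\<forall>u\<in>orb3c. tensor_rank u = 2"
  proof
    fix u assume u: "u \<in> orb3c"
    have "\<not> decomposable u" using orb3_covariants u decomposable_in_zeros by blast
    moreover obtain a b c a' b' where "u = tensor a b' c + tensor a' b c"
      using u unfolding orb3c_def by blast
    ultimately show "tensor_rank u = 2" using tensor_rank_2 dec by blast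
  qed
  show "\<forall>u\<in>orb4. tensor_rank u = 1"
    using orb4_decomposable tensor_rank_1 by blast
qed

lemma orb4_eq: "orb4 = {u \<in> UNIV - {0}. decomposable u}"
proof
  show "orb4 \<subseteq> {u \<in> UNIV - {0}. decomposable u}" using orb4_decomposable by blast
  show "{u \<in> UNIV - {0}. decomposable u} \<subseteq> orb4"
    unfolding strata(6)[symmetric] using decomposable_in_zeros by blast
qed

section \<open>Zariski topologies\<close>

lemma poly_fun_diff: "poly_fun p \<Longrightarrow> poly_fun q \<Longrightarrow> poly_fun (\<lambda>u. p u - q u)"
  using poly_fun_add[OF _ poly_fun_mult[OF poly_fun_const[of "- 1"]], of p q] by simp

lemmas poly_fun_intros = poly_fun_diff poly_fun_add poly_fun_mult poly_fun_coord poly_fun_const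

lemma poly_fun_covariants:
  "poly_fun d12" "poly_fun omega12" "poly_fun eta12"
  unfolding covariant_defs[abs_def] by (intro poly_fun_intros)+

lemma poly_fun_f4: "poly_fun f4"
  unfolding f4_def[abs_def] power2_eq_square
  by (intro poly_fun_intros poly_fun_covariants)

lemma poly_fun_rho3_gens: "p \<in> rho3_gens \<Longrightarrow> poly_fun p"
  unfolding rho3_gens_def using poly_fun_covariants
  by (auto intro!: poly_fun_intros)

lemma covariants_scale:
  "d12 (t *s u) = t\<^sup>2 * d12 u" "omega12 (t *s u) = t\<^sup>2 * omega12 u" "eta12 (t *s u) = t\<^sup>2 * eta12 u"
  "d13 (t *s u) = t\<^sup>2 * d13 u" "omega13 (t *s u) = t\<^sup>2 * omega13 u" "eta13 (t *s u) = t\<^sup>2 * eta13 u"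
  "d23 (t *s u) = t\<^sup>2 * d23 u" "omega23 (t *s u) = t\<^sup>2 * omega23 u" "eta23 (t *s u) = t\<^sup>2 * eta23 u"
  by (simp_all add: covariant_defs power2_eq_square algebra_simps)

lemma f4_scale: "f4 (t *s u) = t ^ 4 * f4 u"
  by (simp add: f4_def covariants_scale power2_eq_square power4_eq_xxxx algebra_simps)

lemma homogeneous_f4: "homogeneous f4"
  unfolding homogeneous_def using f4_scale by blast

lemma homogeneous_rho3_gens: "p \<in> rho3_gens \<Longrightarrow> homogeneous p"
  unfolding homogeneous_def
  by (rule exI[of _ 3])
    (auto simp: rho3_gens_def covariants_scale power2_eq_square power3_eq_cube algebra_simps)

lemma continuous_on_poly_fun: "poly_fun p \<Longrightarrow> continuous_on UNIV p"
  by (induction rule: poly_fun.induct) (auto intro!: continuous_intros)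

lemma open_compl_zeros: "poly_fun p \<Longrightarrow> open (- zeros {p})"
  by (simp add: zeros_def open_closed closed_Collect_eq continuous_on_poly_fun)

text \<open>This reduces failure of Zariski openness to failure of Euclidean openness.\<close>

lemma openin_zariski_imp_open:
  assumes "openin zariski U"
  shows "open U"
proof -
  have "generate_topology_on {- zeros {p} | p. poly_fun p} U"
    using assms by (simp add: zariski_def openin_topology_generated_by_iff)
  then show ?thesis
    by induction (auto intro: open_compl_zeros)
qed

lemma openin_zariski_compl_zeros:
  assumes "\<And>p. p \<in> S \<Longrightarrow> poly_fun p"
  shows "openin zariski (- zeros S)"
proof -
  have "- zeros S = (\<Union>p\<in>S. - zeros {p})" by (auto simp: zeros_def)
  also have "openin zariski \<dots>"
    unfolding zariski_def using assms by (blast intro: openin_Union topology_generated_by_Basis)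
  finally show ?thesis .
qed

lemma f4_dense:
  assumes "open U" "u \<in> U"
  obtains v where "v \<in> U" "f4 v \<noteq> 0"
proof -
  define r :: V where "r = tensor (ee 1) (ee 1) (ee 1) + tensor (ee 2) (ee 2) (ee 2)"
  define g where "g t = u + t *s r" for t
  have r: "r $ (i, j, k) = (if i = j \<and> j = k then 1 else 0)" for i j k
    using exhaust_2[of i] exhaust_2[of j] exhaust_2[of k] by (auto simp: r_def ee_def axis_def)
  \<comment> \<open>Adding \<open>t\<close> to the coordinates 111 and 222 makes
    \<open>omega12\<close> monic quadratic in \<open>t\<close>, while \<open>d12\<close> and
    \<open>eta12\<close> become at most linear. So only the square contributes to the coefficient of
    t^4.\<close>
  define q :: "complex poly" where "q = [: u $ (1,1,1) * u $ (2,2,2) + u $ (1,1,2) * u $ (2,2,1)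
      - u $ (1,2,1) * u $ (2,1,2) - u $ (1,2,2) * u $ (2,1,1), u $ (1,1,1) + u $ (2,2,2), 1 :] ^ 2
    - [:4:] * [: d12 u, u $ (2,2,1) :] * [: eta12 u, u $ (1,1,2) :]"
  have q: "f4 (g t) = poly q t" for t
    by (simp add: q_def f4_def covariant_defs g_def r algebra_simps)
  have "coeff q 4 = 1"
    by (simp add: q_def power2_eq_square eval_nat_numeral)
  then have "q \<noteq> 0" by auto
  then have "finite {t. poly q t = 0}" by (rule poly_roots_finite)
  moreover have "continuous_on UNIV g"
    unfolding g_def vector_scalar_mult_def by (intro continuous_intros)
  then have "open (g -` U)" using assms(1) by (simp add: open_vimage)
  moreover have "0 \<in> g -` U" using assms(2) by (simp add: g_def)
  \<comment> \<open>A nonempty open subset of the complex plane is infinite, whereas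
    \<open>q\<close> has finitely many roots.\<close>
  ultimately have "\<not> g -` U \<subseteq> {t. poly q t = 0}"
    using finite_imp_not_open finite_subset by blast
  then obtain t where "g t \<in> U" "poly q t \<noteq> 0" by auto
  then show ?thesis using that[of "g t"] q by simp
qed

lemma orb_subset_f4:
  "orb2 \<subseteq> zeros {f4}" "orb3a \<subseteq> zeros {f4}" "orb3b \<subseteq> zeros {f4}" "orb3c \<subseteq> zeros {f4}" "orb4 \<subseteq> zeros {f4}"
  using zeros_pi_subset unfolding strata[symmetric] by blast+

lemma orb_not_open: "X \<in> {orb2, orb3a, orb3b, orb3c, orb4} \<Longrightarrow> \<not> open X"
proof
  assume X: "X \<in> {orb2, orb3a, orb3b, orb3c, orb4}" and "open X"
  then obtain u where "u \<in> X" using orb_nonempty by blast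
  then obtain v where "v \<in> X" "f4 v \<noteq> 0" using f4_dense \<open>open X\<close> by metis
  then show False using X orb_subset_f4 mem_zeros_iff(1) by blast
qed

lemma orb1_eq: "orb1 = - zeros {f4}"
  using strata(1) zero_mem_zeros(1) by blast

lemma open_orbits_act: "{X \<in> orbits G (UNIV - {0}) act. openin zariski X} = {orb1}"
proof -
  have "openin zariski orb1"
    unfolding orb1_eq using openin_zariski_compl_zeros[of "{f4}"] poly_fun_f4 by simp
  then show ?thesis
    unfolding orbits_act using orb_not_open openin_zariski_imp_open by blast
qed

lemma openin_orb2: "openin (subtopology zariski (zeros {f4})) orb2"
proof -
  have "orb2 = - zeros rho3_gens \<inter> zeros {f4}"
    using strata(2) zero_mem_zeros(2) unfolding zeros_rho3 by blast
  then show ?thesis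
    unfolding openin_subtopology using openin_zariski_compl_zeros poly_fun_rho3_gens by blast
qed

section \<open>Projective space\<close>

abbreviation line :: "V \<Rightarrow> V set" where
  "line u \<equiv> vec.span {u}"

lemma line_eq: "line u = range (\<lambda>t. t *s u)"
  by (rule vec.span_singleton)

lemma PV_eq: "PV = line ` (UNIV - {0})"
proof
  show "line ` (UNIV - {0}) \<subseteq> PV"
    by (auto simp: PV_def vec.dim_eq_card_independent)
  show "PV \<subseteq> line ` (UNIV - {0})"
  proof
    fix L assume "L \<in> PV"
    then have L: "vec.subspace L" "vec.dim L = 1" by (auto simp: PV_def)
    obtain B where B: "B \<subseteq> L" "vec.independent B" "L \<subseteq> vec.span B" "card B = vec.dim L"
      using vec.basis_exists by blast
    then obtain b where b: "B = {b}" using L card_1_singletonE by metis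
    then have "b \<noteq> 0" using B(2) by simp
    moreover have "L = line b"
      using B L(1) b vec.span_minimal[of B L] by (intro equalityI) simp_all
    ultimately show "L \<in> line ` (UNIV - {0})" by blast
  qed
qed

text \<open>The scalar 0 is excluded so that orbits, which miss the origin, can be cones.\<close>

definition cone :: "V set \<Rightarrow> bool" where
  "cone X \<longleftrightarrow> (\<forall>u\<in>X. \<forall>t. t \<noteq> 0 \<longrightarrow> t *s u \<in> X)"

lemma line_mem_image_iff:
  assumes "cone X" "u \<noteq> 0"
  shows "line u \<in> line ` X \<longleftrightarrow> u \<in> X"
proof
  assume "line u \<in> line ` X"
  then obtain v where v: "v \<in> X" "line u = line v" by blast
  then have "u \<in> line v" using vec.span_base[of u "{u}"] by simp
  then obtain t where "u = t *s v" by (auto simp: line_eq)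
  then show "u \<in> X" using assms v by (auto simp: cone_def)
qed blast

lemma cone_zeros:
  "cone (zeros {f4})" "cone (zeros rho3)" "cone (zeros pi12)" "cone (zeros pi13)" "cone (zeros pi23)"
  by (auto simp: cone_def mem_zeros_iff f4_scale covariants_scale mult.left_commute mult.assoc
      right_diff_distrib[symmetric])

lemma cone_Int: "cone X \<Longrightarrow> cone Y \<Longrightarrow> cone (X \<inter> Y)"
  by (auto simp: cone_def)

text \<open>Cones are also closed under division by nonzero scalars, so scaling cannot lead from
  outside \<open>Y\<close> into \<open>Y\<close>.\<close>

lemma cone_Diff: "cone X \<Longrightarrow> cone Y \<Longrightarrow> cone (X - Y)"
proof -
  assume "cone X" "cone Y"
  have "u \<in> Y" if "t *s u \<in> Y" "t \<noteq> 0" for t u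
  proof -
    have "inverse t *s (t *s u) \<in> Y" using that \<open>cone Y\<close> nonzero_imp_inverse_nonzero
      unfolding cone_def by blast
    then show ?thesis using that by (simp add: vector_smult_assoc)
  qed
  then show ?thesis using \<open>cone X\<close> by (auto simp: cone_def)
qed

lemma cone_nonzero: "cone (UNIV - {0})"
  by (simp add: cone_def)

lemma cone_orb: "cone orb1" "cone orb2" "cone orb3a" "cone orb3b" "cone orb3c" "cone orb4"
  unfolding strata[symmetric] by (intro cone_Diff cone_Int cone_zeros cone_nonzero)+

lemma line_subset_iff:
  assumes "cone X" "0 \<in> X"
  shows "line u \<subseteq> X \<longleftrightarrow> u \<in> X"
proof
  show "u \<in> X" if "line u \<subseteq> X" using that vec.span_base[of u "{u}"] by auto
  show "line u \<subseteq> X" if "u \<in> X"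
  proof -
    have "t *s u \<in> X" for t
      using that assms by (cases "t = 0") (auto simp: cone_def)
    then show ?thesis by (auto simp: line_eq)
  qed
qed

lemma line_in_pzeros_iff:
  assumes "u \<noteq> 0"
  shows "line u \<in> pzeros {f4} \<longleftrightarrow> u \<in> zeros {f4}" "line u \<in> pzeros rho3 \<longleftrightarrow> u \<in> zeros rho3"
    "line u \<in> pzeros pi12 \<longleftrightarrow> u \<in> zeros pi12" "line u \<in> pzeros pi13 \<longleftrightarrow> u \<in> zeros pi13"
    "line u \<in> pzeros pi23 \<longleftrightarrow> u \<in> zeros pi23"
  using assms unfolding pzeros_def PV_eq
  by (simp_all add: line_subset_iff cone_zeros zero_mem_zeros)

lemma projective_strata:
  "PV - pzeros {f4} = line ` orb1"
  "pzeros {f4} - pzeros rho3 = line ` orb2"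
  "pzeros pi12 \<inter> pzeros pi13 - pzeros pi23 = line ` orb3a"
  "pzeros pi12 \<inter> pzeros pi23 - pzeros pi13 = line ` orb3b"
  "pzeros pi13 \<inter> pzeros pi23 - pzeros pi12 = line ` orb3c"
  "pzeros pi12 \<inter> pzeros pi13 \<inter> pzeros pi23 = line ` orb4"
proof -
  \<comment> \<open>Sets of lines are compared through the nonzero vectors that span their
    members.\<close>
  have eqI: "\<P> = line ` X" if "\<P> \<subseteq> PV" "X \<subseteq> UNIV - {0}" "\<And>u. u \<noteq> 0 \<Longrightarrow> line u \<in> \<P> \<longleftrightarrow> u \<in> X"
    for \<P> X using that unfolding PV_eq by blast
  have PV: "pzeros S \<subseteq> PV" for S by (auto simp: pzeros_def)
  have nz: "orb1 \<subseteq> UNIV - {0}" "orb2 \<subseteq> UNIV - {0}" "orb3a \<subseteq> UNIV - {0}" "orb3b \<subseteq> UNIV - {0}"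
    "orb3c \<subseteq> UNIV - {0}" "orb4 \<subseteq> UNIV - {0}"
    unfolding strata[symmetric] by blast+
  note mem = line_in_pzeros_iff
  show "PV - pzeros {f4} = line ` orb1"
    by (rule eqI[OF _ nz(1)]) (use PV in \<open>auto simp: mem strata[symmetric] PV_eq\<close>)
  show "pzeros {f4} - pzeros rho3 = line ` orb2"
    by (rule eqI[OF _ nz(2)]) (use PV in \<open>auto simp: mem strata[symmetric]\<close>)
  show "pzeros pi12 \<inter> pzeros pi13 - pzeros pi23 = line ` orb3a"
    by (rule eqI[OF _ nz(3)]) (use PV in \<open>auto simp: mem strata[symmetric]\<close>)
  show "pzeros pi12 \<inter> pzeros pi23 - pzeros pi13 = line ` orb3b"
    by (rule eqI[OF _ nz(4)]) (use PV in \<open>auto simp: mem strata[symmetric]\<close>)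
  show "pzeros pi13 \<inter> pzeros pi23 - pzeros pi12 = line ` orb3c"
    by (rule eqI[OF _ nz(5)]) (use PV in \<open>auto simp: mem strata[symmetric]\<close>)
  show "pzeros pi12 \<inter> pzeros pi13 \<inter> pzeros pi23 = line ` orb4"
    by (rule eqI[OF _ nz(6)]) (use PV in \<open>auto simp: mem strata[symmetric]\<close>)
qed

section \<open>Orbits of lines\<close>

lemma pact_line: "pact g (line u) = line (act g u)"
  by (simp add: pact_def line_eq image_image act_scale)

lemma orbit_pact_line: "orbit G pact (line u) = line ` orbit G act u"
  unfolding orbit_def by (auto simp: pact_line)

lemma orbits_pact: "orbits G PV pact = (`) line ` orbits G (UNIV - {0}) act"
  unfolding orbits_def PV_eq setcompr_eq_image Collect_mem_eq image_image orbit_pact_line ..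

lemma Collect_line_in_image:
  assumes "cone X" "X \<subseteq> UNIV - {0}"
  shows "{u. u \<noteq> 0 \<and> line u \<in> line ` X} = X"
proof (rule Set.set_eqI)
  show "u \<in> {u. u \<noteq> 0 \<and> line u \<in> line ` X} \<longleftrightarrow> u \<in> X" for u
    using line_mem_image_iff[OF assms(1), of u] assms(2) by (cases "u = 0") auto
qed

lemma orbit_cone:
  assumes "X \<in> orbits G (UNIV - {0}) act"
  shows "cone X" "X \<subseteq> UNIV - {0}"
proof -
  show "cone X" using assms cone_orb unfolding orbits_act by blast
  show "X \<subseteq> UNIV - {0}" using assms unfolding orbits_act strata[symmetric] by blast
qed

lemma card_orbits_pact: "card (orbits G PV pact) = 6"
proof -
  have "inj_on ((`) line) (orbits G (UNIV - {0}) act)"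
    \<comment> \<open>Each orbit is a cone without the origin and is recovered from its lines as the
      set of their nonzero vectors.\<close>
    by (rule inj_on_inverseI[where g = "\<lambda>\<P>. {u. u \<noteq> 0 \<and> line u \<in> \<P>}"])
      (intro Collect_line_in_image orbit_cone)
  then show ?thesis by (simp add: orbits_pact card_image card_orbits_act)
qed

text \<open>Passing to the punctured cone over a set of lines commutes with unions and finite
  intersections, so only basic sets need an argument. It carries \<open>orb_not_open\<close> over to
  projective space.\<close>

lemma openin_pzariski_imp_open:
  assumes "openin pzariski \<U>"
  shows "open {u. u \<noteq> 0 \<and> line u \<in> \<U>}"
proof -
  have "generate_topology_on {PV - pzeros {p} | p. poly_fun p \<and> homogeneous p} \<U>"
    using assms by (simp add: pzariski_def openin_topology_generated_by_iff)
  then show ?thesis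
  proof induction
    case (Int \<A> \<B>)
    have "{u. u \<noteq> 0 \<and> line u \<in> \<A> \<inter> \<B>} = {u. u \<noteq> 0 \<and> line u \<in> \<A>} \<inter> {u. u \<noteq> 0 \<and> line u \<in> \<B>}"
      by blast
    then show ?case using Int.IH by (simp add: open_Int)
  next
    case (UN K)
    have "{u. u \<noteq> 0 \<and> line u \<in> \<Union>K} = (\<Union>\<A>\<in>K. {u. u \<noteq> 0 \<and> line u \<in> \<A>})" by blast
    then show ?case using UN.IH by auto
  next
    case (Basis \<A>)
    then obtain p where p: "\<A> = PV - pzeros {p}" "poly_fun p" "homogeneous p" by blast
    then obtain d where d: "\<And>t u. p (t *s u) = t ^ d * p u" by (auto simp: homogeneous_def)
    \<comment> \<open>Homogeneity makes vanishing at one spanning vector the same as vanishing on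
      the line.\<close>
    have "line u \<subseteq> zeros {p} \<longleftrightarrow> p u = 0" for u
    proof
      show "p u = 0" if "line u \<subseteq> zeros {p}"
        using that vec.span_base[of u "{u}"] by (auto simp: zeros_def)
      show "line u \<subseteq> zeros {p}" if "p u = 0" using that by (auto simp: line_eq zeros_def d)
    qed
    then have "{u. u \<noteq> 0 \<and> line u \<in> \<A>} = (- {0}) \<inter> (- zeros {p})"
      unfolding p(1) pzeros_def by (auto simp: PV_eq zeros_def)
    then show ?case using open_compl_zeros[OF p(2)] by auto
  qed simp
qed

lemma openin_pzariski_compl_pzeros:
  assumes "\<And>p. p \<in> S \<Longrightarrow> poly_fun p \<and> homogeneous p"
  shows "openin pzariski (PV - pzeros S)"
proof -
  have "PV - pzeros S = (\<Union>p\<in>S. PV - pzeros {p})" by (auto simp: pzeros_def zeros_def)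
  also have "openin pzariski \<dots>"
    unfolding pzariski_def using assms by (blast intro: openin_Union topology_generated_by_Basis)
  finally show ?thesis .
qed

lemma open_orbits_pact: "{X \<in> orbits G PV pact. openin pzariski X} = {line ` orb1}"
proof -
  have "openin pzariski (line ` orb1)"
    unfolding projective_strata[symmetric]
    using openin_pzariski_compl_pzeros[of "{f4}"] poly_fun_f4 homogeneous_f4 by simp
  moreover have "\<not> openin pzariski (line ` X)" if X: "X \<in> {orb2, orb3a, orb3b, orb3c, orb4}" for X
  proof
    assume *: "openin pzariski (line ` X)"
    have "X \<in> orbits G (UNIV - {0}) act" using X unfolding orbits_act by blast
    then have "{u. u \<noteq> 0 \<and> line u \<in> line ` X} = X"
      by (intro Collect_line_in_image orbit_cone)
    then show False using openin_pzariski_imp_open[OF *] orb_not_open[OF X] by simp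
  qed
  ultimately show ?thesis
    unfolding orbits_pact orbits_act by blast
qed

lemma openin_projective_orb2: "openin (subtopology pzariski (pzeros {f4})) (line ` orb2)"
proof -
  have "line ` orb2 = (PV - pzeros rho3_gens) \<inter> pzeros {f4}"
    unfolding projective_strata[symmetric] by (auto simp: pzeros_def zeros_rho3)
  moreover have "openin pzariski (PV - pzeros rho3_gens)"
    using openin_pzariski_compl_pzeros poly_fun_rho3_gens homogeneous_rho3_gens by blast
  ultimately show ?thesis unfolding openin_subtopology by blast
qed

lemma tensor_rank_line:
  assumes "\<forall>u\<in>X. tensor_rank u = r" "cone X"
  shows "\<forall>L\<in>line ` X. \<forall>u\<in>L - {0}. tensor_rank u = r"
proof (intro ballI)
  fix L v assume "L \<in> line ` X" "v \<in> L - {0}"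
  then obtain u t where "u \<in> X" "v = t *s u" "t \<noteq> 0" by (auto simp: line_eq)
  then show "tensor_rank v = r" using assms by (auto simp: cone_def)
qed

lemma projective_orb4_eq: "line ` orb4 = {L \<in> PV. \<forall>u\<in>L. decomposable u}"
proof -
  have "(\<forall>v\<in>line u. decomposable v) \<longleftrightarrow> decomposable u" for u
  proof -
    have "t *s tensor a b c = tensor (t *s a) b c" for t a b c by (simp add: V_eq_iff)
    then have "cone {u. decomposable u}" unfolding cone_def decomposable_def by blast
    then show ?thesis using line_subset_iff[of "{u. decomposable u}" u] decomposable_zero by blast
  qed
  then show ?thesis unfolding orb4_eq PV_eq by auto
qed

theorem proposition2p30:
  shows
   "(let
       V\<^sub>0 = UNIV - {0 :: V};
       O1 = V\<^sub>0 - zeros {f4};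
       O2 = (V\<^sub>0 \<inter> zeros {f4}) - zeros rho3;
       O3a = (V\<^sub>0 \<inter> zeros pi12 \<inter> zeros pi13) - zeros pi23;
       O3b = (V\<^sub>0 \<inter> zeros pi12 \<inter> zeros pi23) - zeros pi13;
       O3c = (V\<^sub>0 \<inter> zeros pi13 \<inter> zeros pi23) - zeros pi12;
       O4 = V\<^sub>0 \<inter> zeros pi12 \<inter> zeros pi13 \<inter> zeros pi23;
       P1 = PV - pzeros {f4};
       P2 = pzeros {f4} - pzeros rho3;
       P3a = (pzeros pi12 \<inter> pzeros pi13) - pzeros pi23;
       P3b = (pzeros pi12 \<inter> pzeros pi23) - pzeros pi13;
       P3c = (pzeros pi13 \<inter> pzeros pi23) - pzeros pi12;
       P4 = pzeros pi12 \<inter> pzeros pi13 \<inter> pzeros pi23;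
       r1 = tensor (ee 1) (ee 1) (ee 1) + tensor (ee 2) (ee 2) (ee 2);
       r2 = tensor (ee 1) (ee 1) (ee 1) + tensor (ee 2) (ee 1) (ee 2) + tensor (ee 2) (ee 2) (ee 1);
       r3a = tensor (ee 1) (ee 1) (ee 2) + tensor (ee 1) (ee 2) (ee 1);
       r3b = tensor (ee 1) (ee 1) (ee 2) + tensor (ee 2) (ee 1) (ee 1);
       r3c = tensor (ee 1) (ee 2) (ee 1) + tensor (ee 2) (ee 1) (ee 1);
       r4 = tensor (ee 1) (ee 1) (ee 1)
     in
       (card (orbits G V\<^sub>0 act) = 6
        \<and> orbits G V\<^sub>0 act = {O1, O2, O3a, O3b, O3c, O4}
        \<and> {X \<in> orbits G V\<^sub>0 act. openin zariski X} = {O1}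
        \<and> openin (subtopology zariski (zeros {f4})) O2
        \<and> O4 = {u \<in> V\<^sub>0. decomposable u}
        \<and> (\<forall>u\<in>O1. tensor_rank u = 2) \<and> O1 = orbit G act r1
        \<and> (\<forall>u\<in>O2. tensor_rank u = 3) \<and> O2 = orbit G act r2
        \<and> (\<forall>u\<in>O3a. tensor_rank u = 2) \<and> O3a = orbit G act r3a
        \<and> (\<forall>u\<in>O3b. tensor_rank u = 2) \<and> O3b = orbit G act r3b
        \<and> (\<forall>u\<in>O3c. tensor_rank u = 2) \<and> O3c = orbit G act r3c
        \<and> (\<forall>u\<in>O4. tensor_rank u = 1) \<and> O4 = orbit G act r4)
     \<and> (card (orbits G PV pact) = 6
        \<and> orbits G PV pact = {P1, P2, P3a, P3b, P3c, P4}
        \<and> {X \<in> orbits G PV pact. openin pzariski X} = {P1}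
        \<and> openin (subtopology pzariski (pzeros {f4})) P2
        \<and> P4 = {L \<in> PV. \<forall>u\<in>L. decomposable u}
        \<and> (\<forall>L\<in>P1. \<forall>u\<in>L - {0}. tensor_rank u = 2) \<and> P1 = orbit G pact (vec.span {r1})
        \<and> (\<forall>L\<in>P2. \<forall>u\<in>L - {0}. tensor_rank u = 3) \<and> P2 = orbit G pact (vec.span {r2})
        \<and> (\<forall>L\<in>P3a. \<forall>u\<in>L - {0}. tensor_rank u = 2) \<and> P3a = orbit G pact (vec.span {r3a})
        \<and> (\<forall>L\<in>P3b. \<forall>u\<in>L - {0}. tensor_rank u = 2) \<and> P3b = orbit G pact (vec.span {r3b})
        \<and> (\<forall>L\<in>P3c. \<forall>u\<in>L - {0}. tensor_rank u = 2) \<and> P3c = orbit G pact (vec.span {r3c})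
        \<and> (\<forall>L\<in>P4. \<forall>u\<in>L - {0}. tensor_rank u = 1) \<and> P4 = orbit G pact (vec.span {r4})))"
  \<comment> \<open>Every set in the statement becomes an \<open>orb\<close> set or its image under
    \<open>line\<close>, so each equation between a stratum and the orbit of its representative
    turns into reflexivity.\<close>
  unfolding Let_def strata projective_strata orbit_representatives orbit_pact_line
    card_orbits_act card_orbits_pact open_orbits_act open_orbits_pact
  by (intro conjI refl orbits_act openin_orb2 orb4_eq orb_tensor_rank
      orbits_pact[unfolded orbits_act image_insert image_empty] openin_projective_orb2
      projective_orb4_eq tensor_rank_line cone_orb)

end
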